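(* Let $G$ be a finitely generated LERF group with positive rank gradient $\nabla G>0$, and let $A,B$ be finitely generated subgroups of infinite index in $G$. Then there exists a finite index subgroup $H$ of $B$ such that the subgroup $\langle A\cup H\rangle$ generated by $A$ and $H$ has infinite index in $G$.
   Context: For a group $U$, $d(U)$ denotes the minimal cardinality of a generating set of $U$. The rank gradient of a finitely generated group $G$ is $\nabla G=\inf_U \frac{d(U)-1}{[G:U]}$, where $U$ ranges over all finite index subgroups of $G$. A group $G$ is LERF (subgroup separable) if every finitely generated subgroup of $G$ is the intersection of some collection of finite index subgroups of $G$. *)

theory Defs
  imports "HOL-Algebra.Algebra" "HOL-Analysis.Analysis"
begin

definition fin_index_in :: "('a, 'b) monoid_scheme \<Rightarrow> 'a set \<Rightarrow> 'a set \<Rightarrow> bool" where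
  "fin_index_in G K H \<longleftrightarrow> finite (rcosets\<^bsub>G\<lparr>carrier := K\<rparr>\<^esub> H)"

definition grp_index :: "('a, 'b) monoid_scheme \<Rightarrow> 'a set \<Rightarrow> nat" where
  "grp_index G H = card (rcosets\<^bsub>G\<^esub> H)"

definition fin_index :: "('a, 'b) monoid_scheme \<Rightarrow> 'a set \<Rightarrow> bool" where
  "fin_index G H \<longleftrightarrow> finite (rcosets\<^bsub>G\<^esub> H)"

definition fg_subgroup :: "('a, 'b) monoid_scheme \<Rightarrow> 'a set \<Rightarrow> bool" where
  "fg_subgroup G U \<longleftrightarrow> subgroup U G \<and> (\<exists>S. finite S \<and> S \<subseteq> U \<and> generate G S = U)"

definition fg_group :: "('a, 'b) monoid_scheme \<Rightarrow> bool" where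
  "fg_group G \<longleftrightarrow> fg_subgroup G (carrier G)"

definition min_gens :: "('a, 'b) monoid_scheme \<Rightarrow> 'a set \<Rightarrow> nat" where
  "min_gens G U = (LEAST n. \<exists>S. finite S \<and> S \<subseteq> U \<and> card S = n \<and> generate G S = U)"

definition rank_gradient :: "('a, 'b) monoid_scheme \<Rightarrow> real" where
  "rank_gradient G = Inf {(real (min_gens G U) - 1) / real (grp_index G U) | U.
                          subgroup U G \<and> fin_index G U}"

definition LERF :: "('a, 'b) monoid_scheme \<Rightarrow> bool" where
  "LERF G \<longleftrightarrow> (\<forall>H. fg_subgroup G H \<longrightarrow>
      (\<exists>\<K>. (\<forall>K\<in>\<K>. subgroup K G \<and> fin_index G K) \<and> H = carrier G \<inter> \<Inter>\<K>))"

end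

theory Submission
  imports Defs
begin

text \<open>
  Write \<open>d(U)\<close> for the minimal number of generators of \<open>U\<close> and \<open>\<rho>\<close> for the rank gradient. A subgroup
  \<open>\<langle>A, B\<rangle>\<close> of finite index contained in \<open>W\<close> satisfies \<open>\<rho> [G : W] \<le> d(A) + d(B)\<close>, so it suffices to make
  \<open>(d(A) + d(B)) / [G : W]\<close> small. LERF puts a finitely generated subgroup of infinite index into
  subgroups of arbitrarily large finite index. Take such \<open>U \<supseteq> A\<close> and \<open>V \<supseteq> B\<close>. By Schreier's bound
  \<open>A' = A \<inter> V\<close> and \<open>B' = B \<inter> U\<close> need few generators compared with \<open>[G : U \<inter> V]\<close>, so \<open>\<langle>A', B'\<rangle>\<close> has
  infinite index. To recover all of \<open>A\<close>, choose \<open>K \<supseteq> \<langle>A', B'\<rangle>\<close> of huge finite index, with normal core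
  \<open>N\<close>. The set \<open>N A B\<close> is covered by boundedly many sets \<open>a K b\<close>, hence occupies a tiny proportion of
  the cosets of \<open>N\<close>. So \<open>H = B \<inter> N A\<close> has index in \<open>B\<close> much smaller than \<open>[G : N A]\<close>, and
  \<open>\<langle>A, H\<rangle> \<subseteq> N A\<close> has too few generators to have finite index.
\<close>

section \<open>Relative index\<close>

text \<open>As in \<^const>\<open>fin_index_in\<close>, \<open>K\<close> may be any set: what is counted are the cosets of \<open>H\<close> meeting \<open>K\<close>.\<close>

definition rel_index :: "('a, 'b) monoid_scheme \<Rightarrow> 'a set \<Rightarrow> 'a set \<Rightarrow> nat" where
  "rel_index G K H = card (rcosets\<^bsub>G\<lparr>carrier := K\<rparr>\<^esub> H)"

lemma fin_index_in_carrier [simp]: "fin_index_in G (carrier G) H \<longleftrightarrow> fin_index G H"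
  by (simp add: fin_index_in_def fin_index_def)

lemma rel_index_carrier [simp]: "rel_index G (carrier G) H = grp_index G H"
  by (simp add: rel_index_def grp_index_def)

lemma rcosets_restrict_eq_image: "rcosets\<^bsub>G\<lparr>carrier := K\<rparr>\<^esub> H = (\<lambda>x. H #>\<^bsub>G\<^esub> x) ` K"
  by (auto simp: RCOSETS_def)

lemma fin_index_in_subset:
  assumes "fin_index_in G L H" "K \<subseteq> L"
  shows "fin_index_in G K H"
  using assms unfolding fin_index_in_def rcosets_restrict_eq_image
  by (meson finite_subset image_mono)

lemma fin_index_imp_fin_index_in:
  "\<lbrakk>fin_index G H; K \<subseteq> carrier G\<rbrakk> \<Longrightarrow> fin_index_in G K H"
  using fin_index_in_subset[of G "carrier G" H K] by simp

lemma rel_index_mono: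
  assumes "fin_index_in G L H" "K \<subseteq> L"
  shows "rel_index G K H \<le> rel_index G L H"
  using assms unfolding rel_index_def fin_index_in_def rcosets_restrict_eq_image
  by (intro card_mono) auto

lemma rel_index_pos:
  assumes "fin_index_in G K H" "K \<noteq> {}"
  shows "rel_index G K H > 0"
  using assms unfolding rel_index_def fin_index_in_def rcosets_restrict_eq_image
  by (simp add: card_gt_0_iff)

definition right_transversal :: "('a, 'b) monoid_scheme \<Rightarrow> 'a set \<Rightarrow> 'a set \<Rightarrow> 'a set \<Rightarrow> bool" where
  "right_transversal G K H R \<longleftrightarrow>
     R \<subseteq> K \<and> bij_betw (\<lambda>r. H #>\<^bsub>G\<^esub> r) R (rcosets\<^bsub>G\<lparr>carrier := K\<rparr>\<^esub> H)"

lemma right_transversal_exists: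
  obtains R where "right_transversal G K H R"
proof -
  obtain R where "R \<subseteq> K" "inj_on (\<lambda>r. H #>\<^bsub>G\<^esub> r) R" "(\<lambda>r. H #>\<^bsub>G\<^esub> r) ` K = (\<lambda>r. H #>\<^bsub>G\<^esub> r) ` R"
    using iffD1[OF subset_image_inj subset_refl] by metis
  then show thesis
    using that by (simp add: right_transversal_def bij_betw_def rcosets_restrict_eq_image)
qed

lemma right_transversal_subset: "right_transversal G K H R \<Longrightarrow> R \<subseteq> K"
  by (simp add: right_transversal_def)

lemma right_transversal_inj:
  assumes "right_transversal G K H R" "r \<in> R" "s \<in> R" "H #>\<^bsub>G\<^esub> r = H #>\<^bsub>G\<^esub> s"
  shows "r = s"
  using assms unfolding right_transversal_def bij_betw_def by (blast dest: inj_onD)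

lemma right_transversal_rep:
  assumes "right_transversal G K H R" "x \<in> K"
  obtains r where "r \<in> R" "H #>\<^bsub>G\<^esub> r = H #>\<^bsub>G\<^esub> x"
  using assms unfolding right_transversal_def bij_betw_def rcosets_restrict_eq_image
  by (metis image_iff)

lemma right_transversal_finite:
  "right_transversal G K H R \<Longrightarrow> finite R \<longleftrightarrow> fin_index_in G K H"
  unfolding right_transversal_def fin_index_in_def using bij_betw_finite by blast

lemma right_transversal_card: "right_transversal G K H R \<Longrightarrow> card R = rel_index G K H"
  unfolding right_transversal_def rel_index_def using bij_betw_same_card by blast

context group
begin

lemma grp_index_pos: "fin_index G H \<Longrightarrow> grp_index G H > 0"
  using rel_index_pos[of G "carrier G" H] by auto

lemma rcos_eq_iff:
  assumes "subgroup H G" "x \<in> carrier G" "y \<in> carrier G"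
  shows "H #> x = H #> y \<longleftrightarrow> x \<otimes> inv y \<in> H"
  using subgroup.rcos_module[OF assms(1) is_group assms(3,2)] assms
  by (metis rcos_self repr_independence)

lemma right_transversal_decomp:
  assumes "subgroup H G" "K \<subseteq> carrier G" "right_transversal G K H R" "x \<in> K"
  obtains h r where "h \<in> H" "r \<in> R" "x = h \<otimes> r"
proof -
  obtain r where r: "r \<in> R" "H #> r = H #> x"
    using right_transversal_rep[OF assms(3,4)] .
  then have "x \<in> H #> r"
    using assms by (simp add: rcos_self subset_iff)
  then show thesis
    using that r(1) unfolding r_coset_def by blast
qed

lemma fin_index_inI:
  assumes "subgroup H G" "K \<subseteq> carrier G" "finite (f ` K)"
    and fibre: "\<And>x y. \<lbrakk>x \<in> K; y \<in> K; f x = f y\<rbrakk> \<Longrightarrow> x \<otimes> inv y \<in> H"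
  shows "fin_index_in G K H"
proof -
  obtain R where R: "right_transversal G K H R"
    using right_transversal_exists .
  have "R \<subseteq> K" using right_transversal_subset[OF R] .
  have "inj_on f R"
  proof (rule inj_onI)
    fix r s assume rs: "r \<in> R" "s \<in> R" and "f r = f s"
    then have "H #> r = H #> s"
      using fibre rcos_eq_iff[OF assms(1)] \<open>R \<subseteq> K\<close> assms(2) by blast
    then show "r = s" using right_transversal_inj[OF R rs] by blast
  qed
  then have "finite R"
    using \<open>R \<subseteq> K\<close> assms(3) by (meson finite_subset image_mono inj_on_finite order_refl)
  then show ?thesis using right_transversal_finite[OF R] by blast
qed

lemma fin_index_Int:
  assumes "subgroup U G" "subgroup V G" "fin_index G U" "fin_index G V"
  shows "fin_index G (U \<inter> V)"
proof -
  have "(\<lambda>x. (U #> x, V #> x)) ` carrier G \<subseteq> (rcosets U) \<times> (rcosets V)"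
    by (auto simp: RCOSETS_def)
  then have "finite ((\<lambda>x. (U #> x, V #> x)) ` carrier G)"
    using assms unfolding fin_index_def by (meson finite_SigmaI finite_subset)
  then have "fin_index_in G (carrier G) (U \<inter> V)"
    using assms by (intro fin_index_inI) (auto simp: rcos_eq_iff subgroups_Inter_pair)
  then show ?thesis by simp
qed

lemma set_mult_rcosets:
  assumes "subgroup H G" "subgroup U G" "H \<subseteq> U" "K \<subseteq> carrier G"
  shows "(\<lambda>C. U <#> C) ` (rcosets\<^bsub>G\<lparr>carrier := K\<rparr>\<^esub> H) = rcosets\<^bsub>G\<lparr>carrier := K\<rparr>\<^esub> U"
proof -
  have "U <#> H = U"
    using assms by (intro set_mult_subgroup_idem subgroup_incl)
  then have "U <#> (H #> x) = U #> x" if "x \<in> K" for x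
    using setmult_rcos_assoc[of U H x] that assms by (auto dest: subgroup.subset)
  then show ?thesis
    unfolding rcosets_restrict_eq_image image_image by (intro image_cong) auto
qed

lemma fin_index_in_supergroup:
  assumes "subgroup H G" "subgroup U G" "H \<subseteq> U" "K \<subseteq> carrier G" "fin_index_in G K H"
  shows "fin_index_in G K U"
  using assms(5) unfolding fin_index_in_def set_mult_rcosets[OF assms(1-4), symmetric] by simp

lemma rel_index_antimono:
  assumes "subgroup H G" "subgroup U G" "H \<subseteq> U" "K \<subseteq> carrier G" "fin_index_in G K H"
  shows "rel_index G K U \<le> rel_index G K H"
  using assms(5) unfolding fin_index_in_def rel_index_def set_mult_rcosets[OF assms(1-4), symmetric]
  by (rule card_image_le)

lemma
  assumes "subgroup B G" "subgroup V G" "K \<subseteq> B"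
  shows fin_index_in_Int: "fin_index_in G K (B \<inter> V) \<longleftrightarrow> fin_index_in G K V"
    and rel_index_Int: "rel_index G K (B \<inter> V) = rel_index G K V"
proof -
  have K: "K \<subseteq> carrier G"
    using assms subgroup.subset by blast
  have BV: "subgroup (B \<inter> V) G"
    using assms by (simp add: subgroups_Inter_pair)
  have coset_eq_iff: "(B \<inter> V) #> x = (B \<inter> V) #> y \<longleftrightarrow> V #> x = V #> y" if "x \<in> K" "y \<in> K" for x y
    using that assms K BV
    by (simp add: rcos_eq_iff subset_iff subgroup.m_closed subgroup.m_inv_closed)
  obtain R where R: "right_transversal G K V R"
    using right_transversal_exists .
  have "R \<subseteq> K" using right_transversal_subset[OF R] .
  then have "inj_on (\<lambda>r. (B \<inter> V) #> r) R"
    using coset_eq_iff right_transversal_inj[OF R] by (intro inj_onI) blast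
  moreover have "(B \<inter> V) #> x \<in> (\<lambda>r. (B \<inter> V) #> r) ` R" if x: "x \<in> K" for x
  proof -
    obtain r where "r \<in> R" "V #> r = V #> x"
      using right_transversal_rep[OF R x] .
    then show ?thesis using coset_eq_iff x \<open>R \<subseteq> K\<close> by blast
  qed
  ultimately have R': "right_transversal G K (B \<inter> V) R"
    using \<open>R \<subseteq> K\<close> unfolding right_transversal_def bij_betw_def rcosets_restrict_eq_image by blast
  show "fin_index_in G K (B \<inter> V) \<longleftrightarrow> fin_index_in G K V"
    using right_transversal_finite[OF R] right_transversal_finite[OF R'] by simp
  show "rel_index G K (B \<inter> V) = rel_index G K V"
    using right_transversal_card[OF R] right_transversal_card[OF R'] by simp
qed

lemma fin_index_in_Int_self:
  assumes "subgroup B G" "subgroup V G" "fin_index G V"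
  shows "fin_index_in G B (B \<inter> V)"
  using fin_index_in_Int[OF assms(1,2) order_refl]
    fin_index_imp_fin_index_in[OF assms(3) subgroup.subset[OF assms(1)]] by blast

lemma right_transversals_mult_inj:
  assumes N: "subgroup N G" and U: "subgroup U G" and "N \<subseteq> U" and K: "K \<subseteq> carrier G"
    and T: "right_transversal G U N T" and R: "right_transversal G K U R"
    and t: "t \<in> T" "t' \<in> T" and r: "r \<in> R" "r' \<in> R"
    and eq: "N #> (t \<otimes> r) = N #> (t' \<otimes> r')"
  shows "t = t' \<and> r = r'"
proof -
  have "t \<in> U" "t' \<in> U"
    using t right_transversal_subset[OF T] by auto
  then have carr: "t \<in> carrier G" "t' \<in> carrier G" "r \<in> carrier G" "r' \<in> carrier G"
    using r right_transversal_subset[OF R] K subgroup.mem_carrier[OF U] by auto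
  have "U #> (t \<otimes> r) = U #> (t' \<otimes> r')"
    using eq carr N U \<open>N \<subseteq> U\<close> by (auto simp: rcos_eq_iff)
  then have "U #> r = U #> r'"
    using carr \<open>t \<in> U\<close> \<open>t' \<in> U\<close> U by (metis coset_join2 coset_mult_assoc subgroup.subset)
  then have "r = r'"
    using right_transversal_inj[OF R r] by blast
  then have "(N #> (t \<otimes> r)) #> inv r = (N #> (t' \<otimes> r)) #> inv r"
    using eq by simp
  then have "N #> t = N #> t'"
    using carr subgroup.subset[OF N] by (simp add: coset_mult_assoc m_assoc)
  then show ?thesis
    using right_transversal_inj[OF T t] \<open>r = r'\<close> by blast
qed

lemma rcosets_set_mult:
  assumes N: "subgroup N G" and U: "subgroup U G" and K: "K \<subseteq> carrier G"
    and T: "right_transversal G U N T" and R: "right_transversal G K U R"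
  shows "rcosets\<^bsub>G\<lparr>carrier := U <#> K\<rparr>\<^esub> N = (\<lambda>(t, r). N #> (t \<otimes> r)) ` (T \<times> R)"
  unfolding rcosets_restrict_eq_image
proof (intro equalityI image_subsetI)
  note subsets = subgroup.subset[OF N] subgroup.subset[OF U]
    right_transversal_subset[OF T] right_transversal_subset[OF R]
  fix x assume "x \<in> U <#> K"
  then obtain u k where x: "u \<in> U" "k \<in> K" "x = u \<otimes> k"
    unfolding set_mult_def by blast
  obtain v r where v: "v \<in> U" "r \<in> R" "k = v \<otimes> r"
    using right_transversal_decomp[OF U K R x(2)] .
  have "u \<otimes> v \<in> U" using x v U by (simp add: subgroup.m_closed)
  then obtain t where t: "t \<in> T" "N #> t = N #> (u \<otimes> v)"
    using right_transversal_rep[OF T] by blast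
  have carr: "u \<in> carrier G" "v \<in> carrier G" "r \<in> carrier G" "t \<in> carrier G"
    using x v t subsets K by auto
  have "N #> x = (N #> (u \<otimes> v)) #> r"
    unfolding x v(3) using carr subsets(1) by (simp add: coset_mult_assoc m_assoc)
  also have "\<dots> = N #> (t \<otimes> r)"
    unfolding t(2)[symmetric] using carr subsets(1) by (simp add: coset_mult_assoc)
  finally show "N #> x \<in> (\<lambda>(t, r). N #> (t \<otimes> r)) ` (T \<times> R)"
    using t v by auto
next
  fix p assume "p \<in> T \<times> R"
  then obtain t r where p: "p = (t, r)" "t \<in> U" "r \<in> K"
    using right_transversal_subset[OF T] right_transversal_subset[OF R] by auto
  then have "t \<otimes> r \<in> U <#> K"
    unfolding set_mult_def by blast
  then show "(\<lambda>(t, r). N #> (t \<otimes> r)) p \<in> (\<lambda>x. N #> x) ` (U <#> K)"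
    using p(1) by simp
qed

lemma rel_index_set_mult:
  assumes N: "subgroup N G" and U: "subgroup U G" and "N \<subseteq> U" and K: "K \<subseteq> carrier G"
  shows "rel_index G (U <#> K) N = rel_index G K U * rel_index G U N"
proof -
  obtain R where R: "right_transversal G K U R"
    using right_transversal_exists .
  obtain T where T: "right_transversal G U N T"
    using right_transversal_exists .
  have "inj_on (\<lambda>(t, r). N #> (t \<otimes> r)) (T \<times> R)"
    using right_transversals_mult_inj[OF assms T R] by (auto intro!: inj_onI)
  then have "rel_index G (U <#> K) N = card T * card R"
    unfolding rel_index_def rcosets_set_mult[OF N U K T R]
    by (simp add: card_image card_cartesian_product)
  then show ?thesis
    using right_transversal_card[OF R] right_transversal_card[OF T] by simp
qed

lemma grp_index_mult:
  assumes "subgroup N G" "subgroup U G" "N \<subseteq> U"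
  shows "grp_index G N = grp_index G U * rel_index G U N"
proof -
  have "x \<in> U <#> carrier G" if "x \<in> carrier G" for x
    using that subgroup.one_closed[OF assms(2)] unfolding set_mult_def by force
  then have "U <#> carrier G = carrier G"
    using setmult_subset_G[OF subgroup.subset[OF assms(2)]] by blast
  then show ?thesis
    using rel_index_set_mult[OF assms subset_refl] by simp
qed

lemma grp_index_mult_rel_index_le:
  assumes U: "subgroup U G" and V: "subgroup V G" "fin_index G V" and "A \<subseteq> U"
  shows "grp_index G U * rel_index G A V \<le> grp_index G (U \<inter> V)"
proof -
  have "fin_index_in G U V"
    using V(2) subgroup.subset[OF U] by (rule fin_index_imp_fin_index_in)
  then have "rel_index G A V \<le> rel_index G U V"
    using \<open>A \<subseteq> U\<close> by (rule rel_index_mono)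
  also have "\<dots> = rel_index G U (U \<inter> V)"
    using rel_index_Int[OF U V(1) subset_refl] by simp
  finally show ?thesis
    using grp_index_mult[of "U \<inter> V" U] U V(1) by (simp add: subgroups_Inter_pair)
qed

lemma subset_if_grp_index_Int_le:
  assumes U: "subgroup U G" "fin_index G U" and V: "subgroup V G" "fin_index G V"
    and le: "grp_index G (U \<inter> V) \<le> grp_index G U"
  shows "U \<subseteq> V"
proof
  fix x assume "x \<in> U"
  have "U \<subseteq> carrier G" using subgroup.subset[OF U(1)] .
  then have fin: "fin_index_in G U V"
    using V(2) by (intro fin_index_imp_fin_index_in)
  have "grp_index G U * rel_index G U V \<le> grp_index G U"
    using grp_index_mult_rel_index_le[OF U(1) V subset_refl] le by linarith
  then have "rel_index G U V \<le> Suc 0"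
    using grp_index_pos[OF U(2)] by simp
  then have "\<forall>C \<in> (\<lambda>x. V #> x) ` U. \<forall>D \<in> (\<lambda>x. V #> x) ` U. C = D"
    using fin unfolding rel_index_def fin_index_in_def rcosets_restrict_eq_image
    by (simp only: card_le_Suc0_iff_eq)
  then have "V #> x = V #> \<one>"
    using \<open>x \<in> U\<close> subgroup.one_closed[OF U(1)] by blast
  then show "x \<in> V"
    using rcos_eq_iff[OF V(1), of x \<one>] \<open>x \<in> U\<close> \<open>U \<subseteq> carrier G\<close> by auto
qed

end

section \<open>Counting cosets in products\<close>

context group
begin

lemma rel_index_UN_le:
  "finite I \<Longrightarrow> rel_index G (\<Union>i\<in>I. K i) H \<le> (\<Sum>i\<in>I. rel_index G (K i) H)"
  unfolding rel_index_def rcosets_restrict_eq_image image_UN by (rule card_UN_le)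

lemma rel_index_translate_le:
  assumes N: "N \<lhd> G" and K: "K \<subseteq> carrier G" "fin_index_in G K N"
    and a: "a \<in> carrier G" and b: "b \<in> carrier G"
  shows "rel_index G ((a <# K) #> b) N \<le> rel_index G K N"
proof -
  have Nc: "N \<subseteq> carrier G" using normal_imp_subgroup[OF N] by (rule subgroup.subset)
  have "N #> (a \<otimes> k \<otimes> b) = (a <# (N #> k)) #> b" if "k \<in> carrier G" for k
  proof -
    have "N #> (a \<otimes> k \<otimes> b) = ((N #> a) #> k) #> b"
      using that a b Nc by (simp add: coset_mult_assoc)
    also have "N #> a = a <# N" using normal.coset_eq[OF N] a by blast
    finally show ?thesis using that a Nc by (simp add: coset_assoc)
  qed
  moreover have "(a <# K) #> b = (\<lambda>k. a \<otimes> k \<otimes> b) ` K"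
    by (auto simp: l_coset_def r_coset_def)
  ultimately have "(\<lambda>x. N #> x) ` ((a <# K) #> b) = (\<lambda>C. (a <# C) #> b) ` (\<lambda>x. N #> x) ` K"
    using K(1) by (simp add: image_image subset_iff cong: image_cong)
  then show ?thesis
    using K(2) unfolding rel_index_def fin_index_in_def rcosets_restrict_eq_image
    by (metis card_image_le)
qed

lemma set_mult_subset_UN_transversals:
  assumes A: "subgroup A G" and B: "subgroup B G" and K: "subgroup K G"
    and R: "right_transversal G A K R" and T: "right_transversal G B K T"
  shows "A <#> K <#> B \<subseteq> (\<Union>(a, b)\<in>R \<times> T. (inv a <# K) #> b)"
proof
  note subsets = subgroup.subset[OF A] subgroup.subset[OF B] subgroup.subset[OF K]
    right_transversal_subset[OF R] right_transversal_subset[OF T]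
  fix d assume "d \<in> A <#> K <#> B"
  then obtain x k y where d: "x \<in> A" "k \<in> K" "y \<in> B" "d = x \<otimes> k \<otimes> y"
    unfolding set_mult_def by blast
  obtain h a where h: "h \<in> K" "a \<in> R" "inv x = h \<otimes> a"
    using right_transversal_decomp[OF K subsets(1) R subgroup.m_inv_closed[OF A d(1)]] .
  obtain l b where l: "l \<in> K" "b \<in> T" "y = l \<otimes> b"
    using right_transversal_decomp[OF K subsets(2) T d(3)] .
  have carr: "x \<in> carrier G" "k \<in> carrier G" "h \<in> carrier G" "a \<in> carrier G"
    "l \<in> carrier G" "b \<in> carrier G"
    using d h l subsets by auto
  have "x = inv a \<otimes> inv h" using h(3) carr by (metis inv_inv inv_mult_group)
  then have "d = inv a \<otimes> (inv h \<otimes> k \<otimes> l) \<otimes> b"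
    unfolding d(4) l(3) using carr by (simp add: m_assoc)
  moreover have "inv h \<otimes> k \<otimes> l \<in> K"
    using d(2) h(1) l(1) K by (simp add: subgroup.m_closed subgroup.m_inv_closed)
  ultimately have "d \<in> (inv a <# K) #> b"
    unfolding l_coset_def r_coset_def by blast
  then show "d \<in> (\<Union>(a, b)\<in>R \<times> T. (inv a <# K) #> b)"
    using h(2) l(2) by blast
qed

lemma rel_index_double_set_mult_le:
  assumes N: "N \<lhd> G" "fin_index G N"
    and A: "subgroup A G" and B: "subgroup B G" and K: "subgroup K G" "fin_index G K"
  shows "rel_index G (A <#> K <#> B) N \<le> rel_index G A K * rel_index G B K * rel_index G K N"
proof -
  note subsets = subgroup.subset[OF A] subgroup.subset[OF B] subgroup.subset[OF K(1)]
  have fin: "fin_index_in G Z N" "fin_index_in G Z K" if "Z \<subseteq> carrier G" for Z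
    using N(2) K(2) that by (auto intro: fin_index_imp_fin_index_in)
  obtain R where R: "right_transversal G A K R" using right_transversal_exists .
  obtain T where T: "right_transversal G B K T" using right_transversal_exists .
  have RT: "finite (R \<times> T)"
    using right_transversal_finite[OF R] right_transversal_finite[OF T] fin(2) subsets by simp
  have carr: "inv a \<in> carrier G" "b \<in> carrier G" if "(a, b) \<in> R \<times> T" for a b
    using that right_transversal_subset[OF R] right_transversal_subset[OF T] subsets by auto
  have "(inv a <# K) #> b \<subseteq> carrier G" if "(a, b) \<in> R \<times> T" for a b
    using carr[OF that] subsets(3) by (intro r_coset_subset_G l_coset_subset_G)
  then have UN: "(\<Union>(a, b)\<in>R \<times> T. (inv a <# K) #> b) \<subseteq> carrier G"
    by blast
  have "rel_index G (A <#> K <#> B) N \<le> rel_index G (\<Union>(a, b)\<in>R \<times> T. (inv a <# K) #> b) N"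
    using set_mult_subset_UN_transversals[OF A B K(1) R T] by (intro rel_index_mono fin UN)
  also have "\<dots> \<le> (\<Sum>(a, b)\<in>R \<times> T. rel_index G ((inv a <# K) #> b) N)"
    using rel_index_UN_le[OF RT] by (simp add: case_prod_beta)
  also have "\<dots> \<le> (\<Sum>p\<in>R \<times> T. rel_index G K N)"
    using carr subsets(3) by (intro sum_mono) (auto intro: rel_index_translate_le[OF N(1)] fin)
  also have "\<dots> = rel_index G A K * rel_index G B K * rel_index G K N"
    using right_transversal_card[OF R] right_transversal_card[OF T]
    by (simp add: card_cartesian_product)
  finally show ?thesis .
qed

lemma second_isomorphism_grpI:
  "\<lbrakk>N \<lhd> G; subgroup A G\<rbrakk> \<Longrightarrow> second_isomorphism_grp N G A"
  by (simp add: second_isomorphism_grp_def second_isomorphism_grp_axioms_def)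

lemma fin_index_normal_set_mult:
  assumes "N \<lhd> G" "fin_index G N" "subgroup A G"
  shows "fin_index G (N <#> A)"
proof -
  interpret second_isomorphism_grp N G A using assms by (intro second_isomorphism_grpI)
  show ?thesis
    using fin_index_in_supergroup[OF subgroup_axioms normal_set_mult_subgroup
        H_contained_in_set_mult order_refl] assms(2) by simp
qed

text \<open>\<open>N A B\<close> consists of \<open>[N A : N]\<close> cosets of \<open>N\<close> for each coset of \<open>N A\<close> meeting \<open>B\<close>; it lies in
  \<open>A K B\<close>, a union of \<open>[A : A \<inter> K] [B : B \<inter> K]\<close> sets \<open>a K b\<close>, each made of \<open>[K : N]\<close> cosets of \<open>N\<close>.\<close>

lemma rel_index_normal_mult_le:
  assumes N: "N \<lhd> G" "fin_index G N" and A: "subgroup A G" and B: "subgroup B G"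
    and K: "subgroup K G" "N \<subseteq> K" "fin_index G K"
  shows "rel_index G B (N <#> A) * grp_index G K
           \<le> rel_index G A K * rel_index G B K * grp_index G (N <#> A)"
proof -
  let ?U = "N <#> A"
  interpret NA: second_isomorphism_grp N G A using N(1) A by (rule second_isomorphism_grpI)
  have Ns: "subgroup N G" using NA.subgroup_axioms .
  note U = NA.normal_set_mult_subgroup and NU = NA.H_contained_in_set_mult
  have Bc: "B \<subseteq> carrier G" using subgroup.subset[OF B] .
  have "?U <#> B \<subseteq> A <#> K <#> B"
    using commut_normal[OF A N(1)] K(2) by (metis mono_set_mult order_refl)
  moreover have "A <#> K <#> B \<subseteq> carrier G"
    using A B K(1) by (intro setmult_subset_G subgroup.subset)
  ultimately have "rel_index G (?U <#> B) N \<le> rel_index G (A <#> K <#> B) N"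
    using N(2) by (intro rel_index_mono fin_index_imp_fin_index_in)
  then have count: "rel_index G B ?U * rel_index G ?U N
      \<le> rel_index G A K * rel_index G B K * rel_index G K N"
    using rel_index_double_set_mult_le[OF N A B K(1,3)] rel_index_set_mult[OF Ns U NU Bc]
    by linarith
  have "(rel_index G B ?U * grp_index G K) * grp_index G N
      = (rel_index G B ?U * rel_index G ?U N) * (grp_index G K * grp_index G ?U)"
    unfolding grp_index_mult[OF Ns U NU] by (simp add: algebra_simps)
  also have "\<dots> \<le> (rel_index G A K * rel_index G B K * rel_index G K N)
      * (grp_index G K * grp_index G ?U)"
    using count by (rule mult_right_mono) simp
  also have "\<dots> = (rel_index G A K * rel_index G B K * grp_index G ?U) * grp_index G N"
    unfolding grp_index_mult[OF Ns K(1,2)] by (simp add: algebra_simps)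
  finally show ?thesis using grp_index_pos[OF N(2)] by simp
qed

end

section \<open>Normal cores\<close>

definition normal_core :: "('a, 'b) monoid_scheme \<Rightarrow> 'a set \<Rightarrow> 'a set" where
  "normal_core G K = {g \<in> carrier G. \<forall>x\<in>carrier G. x \<otimes>\<^bsub>G\<^esub> g \<otimes>\<^bsub>G\<^esub> inv\<^bsub>G\<^esub> x \<in> K}"

context group
begin

lemma normal_core_subset: "normal_core G K \<subseteq> K"
proof
  fix g assume "g \<in> normal_core G K"
  then have "g \<in> carrier G" "\<one> \<otimes> g \<otimes> inv \<one> \<in> K"
    unfolding normal_core_def by blast+
  then show "g \<in> K" by simp
qed

lemma subgroup_normal_core:
  assumes "subgroup K G"
  shows "subgroup (normal_core G K) G"
proof (rule subgroupI)
  show "normal_core G K \<subseteq> carrier G" "normal_core G K \<noteq> {}"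
    using subgroup.one_closed[OF assms] by (auto simp: normal_core_def)
next
  fix g assume g: "g \<in> normal_core G K"
  then have "inv (x \<otimes> g \<otimes> inv x) \<in> K" if "x \<in> carrier G" for x
    using that subgroup.m_inv_closed[OF assms] by (auto simp: normal_core_def)
  then show "inv g \<in> normal_core G K"
    using g by (simp add: normal_core_def inv_mult_group m_assoc)
next
  fix g h assume gh: "g \<in> normal_core G K" "h \<in> normal_core G K"
  then have "(x \<otimes> g \<otimes> inv x) \<otimes> (x \<otimes> h \<otimes> inv x) \<in> K" if "x \<in> carrier G" for x
    using that subgroup.m_closed[OF assms] by (auto simp: normal_core_def)
  moreover have "(x \<otimes> g \<otimes> inv x) \<otimes> (x \<otimes> h \<otimes> inv x) = x \<otimes> (g \<otimes> h) \<otimes> inv x"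
    if "x \<in> carrier G" for x
    using that gh by (simp add: normal_core_def m_assoc inv_solve_left')
  ultimately show "g \<otimes> h \<in> normal_core G K"
    using gh by (simp add: normal_core_def)
qed

lemma normal_normal_core:
  assumes "subgroup K G"
  shows "normal_core G K \<lhd> G"
proof (rule normal_invI[OF subgroup_normal_core[OF assms]])
  fix x g assume x: "x \<in> carrier G" and g: "g \<in> normal_core G K"
  then have "(y \<otimes> x) \<otimes> g \<otimes> inv (y \<otimes> x) \<in> K" if "y \<in> carrier G" for y
    using that by (auto simp: normal_core_def)
  then show "x \<otimes> g \<otimes> inv x \<in> normal_core G K"
    using x g by (simp add: normal_core_def inv_mult_group m_assoc)
qed

text \<open>The core is the kernel of the action of \<open>G\<close> on the finitely many cosets of \<open>K\<close>.\<close>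

lemma fin_index_normal_core:
  assumes K: "subgroup K G" and "fin_index G K"
  shows "fin_index G (normal_core G K)"
proof -
  let ?act = "\<lambda>g. \<lambda>C\<in>rcosets K. C #> g"
  have Kc: "K \<subseteq> carrier G" using subgroup.subset[OF K] .
  have "C #> g \<in> rcosets K" if C: "C \<in> rcosets K" and g: "g \<in> carrier G" for C g
  proof -
    obtain x where "x \<in> carrier G" "C = K #> x" using C by (auto simp: RCOSETS_def)
    then show ?thesis using g Kc by (simp add: coset_mult_assoc rcosetsI)
  qed
  then have "?act ` carrier G \<subseteq> (rcosets K) \<rightarrow>\<^sub>E (rcosets K)" by auto
  then have "finite (?act ` carrier G)"
    using assms(2) finite_PiE[of "rcosets K" "\<lambda>_. rcosets K"] finite_subset
    unfolding fin_index_def by blast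
  then have "fin_index_in G (carrier G) (normal_core G K)"
  proof (rule fin_index_inI[OF subgroup_normal_core[OF K] order_refl])
    fix g h assume gh: "g \<in> carrier G" "h \<in> carrier G" and act: "?act g = ?act h"
    have "x \<otimes> (g \<otimes> inv h) \<otimes> inv x \<in> K" if x: "x \<in> carrier G" for x
    proof -
      have "(K #> x) #> g = (K #> x) #> h"
        using fun_cong[OF act, of "K #> x"] rcosetsI[OF Kc x] by simp
      then have "(x \<otimes> g) \<otimes> inv (x \<otimes> h) \<in> K"
        using x gh Kc by (simp add: coset_mult_assoc rcos_eq_iff[OF K])
      then show ?thesis using x gh by (simp add: inv_mult_group m_assoc)
    qed
    then show "g \<otimes> inv h \<in> normal_core G K" using gh by (simp add: normal_core_def)
  qed
  then show ?thesis by simp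
qed

end

section \<open>Schreier generators\<close>

locale schreier_transversal = group G for G (structure) +
  fixes H S R
  assumes subgroup_H: "subgroup H G"
    and S_subset: "S \<subseteq> carrier G"
    and H_subset: "H \<subseteq> generate G S"
    and transversal: "right_transversal G (generate G S) H R"
begin

text \<open>Intersecting with \<open>H\<close> forces \<open>r'\<close> to be the representative of the coset \<open>H r s\<close>, and the
  inverse of an element \<open>r s\<^sup>-\<^sup>1 r'\<^sup>-\<^sup>1\<close> of \<open>H\<close> is again of this form.\<close>

definition schreier_gens :: "'a set" where
  "schreier_gens = {r \<otimes> s \<otimes> inv r' | r s r'. r \<in> R \<and> s \<in> S \<and> r' \<in> R} \<inter> H"

lemma subgroup_generate_S: "subgroup (generate G S) G"
  using S_subset by (rule generate_is_subgroup)

lemma R_subset_generate: "R \<subseteq> generate G S"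
  using transversal by (rule right_transversal_subset)

lemma R_subset_carrier: "R \<subseteq> carrier G"
  using R_subset_generate subgroup.subset[OF subgroup_generate_S] by blast

lemma generate_schreier_gens_subset: "generate G schreier_gens \<subseteq> H"
  using subgroup_H by (intro generate_subgroup_incl) (auto simp: schreier_gens_def)

lemma subgroup_generate_schreier_gens: "subgroup (generate G schreier_gens) G"
  using subgroup.subset[OF subgroup_H] by (intro generate_is_subgroup) (auto simp: schreier_gens_def)

lemma
  assumes "finite S" "finite R"
  shows finite_schreier_gens: "finite schreier_gens"
    and card_schreier_gens_le: "card schreier_gens \<le> card R * card S"
proof -
  have "\<forall>b\<in>generate G S. \<exists>r\<in>R. H #> r = H #> b"
    using right_transversal_rep[OF transversal] by metis
  then obtain rep where rep: "\<And>b. b \<in> generate G S \<Longrightarrow> rep b \<in> R \<and> H #> rep b = H #> b"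
    by metis
  have "r' = rep (r \<otimes> s)"
    if r: "r \<in> R" "r' \<in> R" and s: "s \<in> S" and "r \<otimes> s \<otimes> inv r' \<in> H" for r s r'
  proof -
    have rs: "r \<otimes> s \<in> generate G S"
      using r s R_subset_generate by (auto intro: generate.eng generate.incl)
    then have "H #> (r \<otimes> s) = H #> r'"
      using rcos_eq_iff[OF subgroup_H] that R_subset_carrier subgroup.mem_carrier[OF subgroup_generate_S]
      by blast
    then show ?thesis
      using right_transversal_inj[OF transversal] rep[OF rs] r(2) by simp
  qed
  then have sub: "schreier_gens \<subseteq> (\<lambda>(r, s). r \<otimes> s \<otimes> inv (rep (r \<otimes> s))) ` (R \<times> S)"
    unfolding schreier_gens_def by fastforce
  with assms show "finite schreier_gens" by (meson finite_SigmaI finite_surj)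
  show "card schreier_gens \<le> card R * card S"
    using surj_card_le[OF _ sub] assms by (simp add: card_cartesian_product)
qed

lemma mult_transversal_decomp:
  assumes r: "r \<in> R" and y: "y \<in> S \<or> (\<exists>s\<in>S. y = inv s)"
  obtains z r' where "z \<in> generate G schreier_gens" "r' \<in> R" "r \<otimes> y = z \<otimes> r'"
proof -
  have "y \<in> generate G S" using y by (auto intro: generate.incl generate.inv)
  then have "r \<otimes> y \<in> generate G S" using r R_subset_generate by (auto intro: generate.eng)
  then obtain h r' where h: "h \<in> H" "r' \<in> R" "r \<otimes> y = h \<otimes> r'"
    using right_transversal_decomp[OF subgroup_H subgroup.subset[OF subgroup_generate_S] transversal]
    by blast
  have carr: "r \<in> carrier G" "y \<in> carrier G" "h \<in> carrier G" "r' \<in> carrier G"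
    using r y h R_subset_carrier S_subset subgroup.mem_carrier[OF subgroup_H] by auto
  have h_eq: "h = r \<otimes> y \<otimes> inv r'" using h(3) carr by (simp add: inv_solve_right)
  have "h \<in> generate G schreier_gens"
    using y
  proof
    assume "y \<in> S"
    then have "h \<in> schreier_gens"
      unfolding schreier_gens_def using h h_eq r by blast
    then show ?thesis by (rule generate.incl)
  next
    assume "\<exists>s\<in>S. y = inv s"
    then obtain s where s: "s \<in> S" "y = inv s" by blast
    moreover from s have "s \<in> carrier G" using S_subset by blast
    ultimately have "inv h = r' \<otimes> s \<otimes> inv r"
      using h_eq carr by (simp add: inv_mult_group m_assoc)
    then have "inv h \<in> schreier_gens"
      unfolding schreier_gens_def using h r s subgroup.m_inv_closed[OF subgroup_H] by blast
    then have "inv (inv h) \<in> generate G schreier_gens" by (rule generate.inv)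
    then show ?thesis using carr by simp
  qed
  with h show thesis by (intro that)
qed

lemma set_mult_transversal_mult_generator:
  assumes d: "d \<in> generate G schreier_gens <#> R" and y: "y \<in> S \<or> (\<exists>s\<in>S. y = inv s)"
  shows "d \<otimes> y \<in> generate G schreier_gens <#> R"
proof -
  obtain z r where z: "z \<in> generate G schreier_gens" "r \<in> R" "d = z \<otimes> r"
    using d unfolding set_mult_def by blast
  obtain z' r' where z': "z' \<in> generate G schreier_gens" "r' \<in> R" "r \<otimes> y = z' \<otimes> r'"
    using mult_transversal_decomp[OF z(2) y] .
  have carr: "z \<in> carrier G" "z' \<in> carrier G" "r \<in> carrier G" "r' \<in> carrier G" "y \<in> carrier G"
    using z z' y R_subset_carrier S_subset subgroup.mem_carrier[OF subgroup_generate_schreier_gens]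
    by auto
  then have "d \<otimes> y = (z \<otimes> z') \<otimes> r'"
    using z(3) z'(3) by (simp add: m_assoc)
  moreover have "z \<otimes> z' \<in> generate G schreier_gens"
    using z(1) z'(1) by (rule generate.eng)
  ultimately show ?thesis
    using z'(2) unfolding set_mult_def by blast
qed

lemma set_mult_transversal_mult_generate:
  assumes "y \<in> generate G S" "d \<in> generate G schreier_gens <#> R"
  shows "d \<otimes> y \<in> generate G schreier_gens <#> R"
proof -
  have carr: "generate G schreier_gens <#> R \<subseteq> carrier G"
    using setmult_subset_G[OF subgroup.subset[OF subgroup_generate_schreier_gens] R_subset_carrier] .
  show ?thesis
    using assms
  proof (induction arbitrary: d)
    case one
    then show ?case using carr by auto
  next
    case (eng y y')
    then have "d \<otimes> (y \<otimes> y') = (d \<otimes> y) \<otimes> y'"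
      using carr generate_in_carrier[OF S_subset] by (intro m_assoc[symmetric]) auto
    then show ?case using eng by simp
  qed (use set_mult_transversal_mult_generator in blast)+
qed

lemma generate_subset_set_mult_transversal: "generate G S \<subseteq> generate G schreier_gens <#> R"
proof
  fix b assume b: "b \<in> generate G S"
  obtain r where r: "r \<in> R" using right_transversal_rep[OF transversal b] by blast
  have "\<one> \<otimes> r \<in> generate G schreier_gens <#> R"
    using r generate.one unfolding set_mult_def by blast
  moreover have "inv r \<otimes> b \<in> generate G S"
    using r R_subset_generate b subgroup_generate_S
    by (auto intro: subgroup.m_closed subgroup.m_inv_closed)
  ultimately have "(\<one> \<otimes> r) \<otimes> (inv r \<otimes> b) \<in> generate G schreier_gens <#> R"
    by (rule set_mult_transversal_mult_generate[rotated])
  moreover have "b \<in> carrier G" "r \<in> carrier G"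
    using b r R_subset_carrier generate_in_carrier[OF S_subset] by auto
  then have "(\<one> \<otimes> r) \<otimes> (inv r \<otimes> b) = b"
    by (simp add: m_assoc[symmetric])
  ultimately show "b \<in> generate G schreier_gens <#> R" by simp
qed

lemma subgroup_mem_decomp:
  assumes "h \<in> H"
  obtains z r where "z \<in> generate G schreier_gens" "r \<in> R" "r \<in> H" "h = z \<otimes> r"
proof -
  obtain z r where z: "z \<in> generate G schreier_gens" "r \<in> R" "h = z \<otimes> r"
    using assms H_subset generate_subset_set_mult_transversal unfolding set_mult_def by blast
  then have "inv z \<otimes> h \<in> H"
    using assms generate_schreier_gens_subset subgroup_H
    by (auto intro: subgroup.m_closed subgroup.m_inv_closed)
  moreover have "z \<in> carrier G" "r \<in> carrier G"
    using z R_subset_carrier subgroup.mem_carrier[OF subgroup_generate_schreier_gens] by auto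
  then have "inv z \<otimes> h = r"
    unfolding z(3) by (simp add: m_assoc[symmetric])
  ultimately show thesis using that z by blast
qed

lemma generate_schreier_gens: "generate G schreier_gens = H"
proof
  show "generate G schreier_gens \<subseteq> H" by (rule generate_schreier_gens_subset)
  \<comment> \<open>\<open>R\<close> need not contain \<open>\<one>\<close>; decomposing \<open>\<one>\<close> shows that its element in \<open>H\<close> is generated.\<close>
  show "H \<subseteq> generate G schreier_gens"
  proof
    fix h assume "h \<in> H"
    then obtain z r where z: "z \<in> generate G schreier_gens" "r \<in> R" "r \<in> H" "h = z \<otimes> r"
      by (rule subgroup_mem_decomp)
    obtain z' r' where z': "z' \<in> generate G schreier_gens" "r' \<in> R" "r' \<in> H" "\<one> = z' \<otimes> r'"
      using subgroup.one_closed[OF subgroup_H] by (rule subgroup_mem_decomp)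
    have "r' = r"
      using right_transversal_inj[OF transversal z'(2) z(2)] z(3) z'(3)
        subgroup.rcos_const[OF subgroup_H is_group] by simp
    then have "inv r = z'"
      using z'(1,4) z(2) R_subset_carrier subgroup.mem_carrier[OF subgroup_generate_schreier_gens]
      by (intro inv_equality) auto
    then have "inv (inv r) \<in> generate G schreier_gens"
      using z'(1) subgroup.m_inv_closed[OF subgroup_generate_schreier_gens] by simp
    then have "r \<in> generate G schreier_gens" using z(2) R_subset_carrier by auto
    then show "h \<in> generate G schreier_gens" using z(1,4) by (simp add: generate.eng)
  qed
qed

end

section \<open>Numbers of generators\<close>

lemma (in group) fg_subgroup_generate:
  "\<lbrakk>finite S; S \<subseteq> carrier G\<rbrakk> \<Longrightarrow> fg_subgroup G (generate G S)"
  unfolding fg_subgroup_def by (auto intro: generate_is_subgroup generate.incl)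

lemma min_gens_generate_le: "finite S \<Longrightarrow> min_gens G (generate G S) \<le> card S"
  unfolding min_gens_def by (intro Least_le exI[of _ S]) (auto intro: generate.incl)

lemma fg_subgroup_imp_subgroup: "fg_subgroup G U \<Longrightarrow> subgroup U G"
  by (simp add: fg_subgroup_def)

lemma fg_subgroup_min_gensE:
  assumes "fg_subgroup G U"
  obtains S where "finite S" "S \<subseteq> U" "generate G S = U" "card S = min_gens G U"
proof -
  have "\<exists>n S. finite S \<and> S \<subseteq> U \<and> card S = n \<and> generate G S = U"
    using assms unfolding fg_subgroup_def by blast
  from LeastI_ex[OF this] show thesis
    using that unfolding min_gens_def by blast
qed

context group
begin

lemma
  assumes B: "fg_subgroup G B" and H: "subgroup H G" "H \<subseteq> B" "fin_index_in G B H"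
  shows fg_subgroup_fin_index: "fg_subgroup G H"
    and min_gens_fin_index_le: "min_gens G H \<le> rel_index G B H * min_gens G B"
proof -
  obtain S where S: "finite S" "S \<subseteq> B" "generate G S = B" "card S = min_gens G B"
    using fg_subgroup_min_gensE[OF B] .
  obtain R where R: "right_transversal G B H R"
    using right_transversal_exists .
  interpret schreier_transversal G H S R
    using S H R subgroup.subset[OF fg_subgroup_imp_subgroup[OF B]]
    by (intro schreier_transversal.intro schreier_transversal_axioms.intro is_group) auto
  have "finite R" using right_transversal_finite[OF R] H(3) by blast
  then have Z: "finite schreier_gens" "card schreier_gens \<le> rel_index G B H * min_gens G B"
    using finite_schreier_gens card_schreier_gens_le S right_transversal_card[OF R] by auto
  moreover have "schreier_gens \<subseteq> carrier G"
    using subgroup.subset[OF H(1)] by (auto simp: schreier_gens_def)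
  ultimately show "fg_subgroup G H"
    using fg_subgroup_generate generate_schreier_gens by metis
  show "min_gens G H \<le> rel_index G B H * min_gens G B"
    using min_gens_generate_le[OF Z(1), of G] Z(2) generate_schreier_gens by simp
qed

lemma generate_Un_generate:
  assumes "S \<subseteq> carrier G" "T \<subseteq> carrier G"
  shows "generate G (generate G S \<union> generate G T) = generate G (S \<union> T)"
proof
  have "generate G S \<union> generate G T \<subseteq> generate G (S \<union> T)"
    using mono_generate[of S "S \<union> T"] mono_generate[of T "S \<union> T"] by blast
  then show "generate G (generate G S \<union> generate G T) \<subseteq> generate G (S \<union> T)"
    using assms by (intro generate_subgroup_incl generate_is_subgroup) auto
  show "generate G (S \<union> T) \<subseteq> generate G (generate G S \<union> generate G T)"
    by (intro mono_generate) (auto intro: generate.incl)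
qed

lemma
  assumes "fg_subgroup G A" "fg_subgroup G B"
  shows fg_subgroup_join: "fg_subgroup G (generate G (A \<union> B))"
    and min_gens_join_le: "min_gens G (generate G (A \<union> B)) \<le> min_gens G A + min_gens G B"
proof -
  obtain S where S: "finite S" "S \<subseteq> A" "generate G S = A" "card S = min_gens G A"
    using fg_subgroup_min_gensE[OF assms(1)] .
  obtain T where T: "finite T" "T \<subseteq> B" "generate G T = B" "card T = min_gens G B"
    using fg_subgroup_min_gensE[OF assms(2)] .
  have ST: "S \<subseteq> carrier G" "T \<subseteq> carrier G"
    using S(2) T(2) assms[THEN fg_subgroup_imp_subgroup] by (auto dest: subgroup.subset)
  then have gen: "generate G (A \<union> B) = generate G (S \<union> T)"
    using generate_Un_generate S(3) T(3) by metis
  then show "fg_subgroup G (generate G (A \<union> B))"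
    using fg_subgroup_generate[of "S \<union> T"] S(1) T(1) ST by simp
  have "min_gens G (generate G (A \<union> B)) \<le> card (S \<union> T)"
    unfolding gen using S(1) T(1) by (intro min_gens_generate_le) simp
  also have "\<dots> \<le> min_gens G A + min_gens G B"
    using card_Un_le[of S T] S(4) T(4) by simp
  finally show "min_gens G (generate G (A \<union> B)) \<le> min_gens G A + min_gens G B" .
qed

lemma rank_gradient_le:
  assumes "subgroup U G" "fin_index G U"
  shows "rank_gradient G \<le> (real (min_gens G U) - 1) / real (grp_index G U)"
  unfolding rank_gradient_def
proof (rule cInf_lower)
  have "-1 \<le> (real (min_gens G V) - 1) / real (grp_index G V)" if "fin_index G V" for V
    using grp_index_pos[OF that] by (simp add: field_simps)
  then show "bdd_below {(real (min_gens G V) - 1) / real (grp_index G V) |V.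
      subgroup V G \<and> fin_index G V}"
    by (intro bdd_belowI[of _ "-1"]) auto
qed (use assms in blast)

lemma not_fin_index_join:
  assumes A: "fg_subgroup G A" "A \<subseteq> W" and B: "fg_subgroup G B" "B \<subseteq> W" and W: "subgroup W G"
    and few: "real (min_gens G A + min_gens G B) / real (grp_index G W) < rank_gradient G"
  shows "\<not> fin_index G (generate G (A \<union> B))"
proof
  let ?L = "generate G (A \<union> B)"
  assume fin: "fin_index G ?L"
  have L: "subgroup ?L G" using fg_subgroup_join[OF A(1) B(1)] by (rule fg_subgroup_imp_subgroup)
  have LW: "?L \<subseteq> W" using A(2) B(2) W by (intro generate_subgroup_incl) auto
  have "fin_index G W" and index_le: "grp_index G W \<le> grp_index G ?L"
    using fin_index_in_supergroup[OF L W LW order_refl] rel_index_antimono[OF L W LW order_refl] fin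
    by simp_all
  have "rank_gradient G \<le> (real (min_gens G ?L) - 1) / real (grp_index G ?L)"
    using L fin by (rule rank_gradient_le)
  also have "\<dots> \<le> real (min_gens G A + min_gens G B) / real (grp_index G ?L)"
    using min_gens_join_le[OF A(1) B(1)] by (intro divide_right_mono) auto
  also have "\<dots> \<le> real (min_gens G A + min_gens G B) / real (grp_index G W)"
    using index_le grp_index_pos[OF \<open>fin_index G W\<close>] by (intro divide_left_mono) auto
  finally show False using few by simp
qed

end

section \<open>Subgroups of infinite index in LERF groups\<close>

context group
begin

text \<open>If the indices were bounded, a \<open>U \<supseteq> A\<close> of maximal finite index would lie in every finite index
  subgroup containing \<open>A\<close>, and so equal \<open>A\<close>.\<close>

lemma LERF_index_unbounded:
  assumes "LERF G" and A: "fg_subgroup G A" "\<not> fin_index G A"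
  obtains U where "subgroup U G" "fin_index G U" "A \<subseteq> U" "n < grp_index G U"
proof (rule ccontr)
  let ?P = "\<lambda>U. subgroup U G \<and> fin_index G U \<and> A \<subseteq> U"
  assume "\<not> thesis"
  then have bound: "\<forall>U. ?P U \<longrightarrow> grp_index G U < Suc n"
    using that by (meson not_less_eq)
  obtain \<K> where \<K>: "\<forall>K\<in>\<K>. subgroup K G \<and> fin_index G K" "A = carrier G \<inter> \<Inter>\<K>"
    using assms unfolding LERF_def by blast
  have "fin_index G (carrier G)"
    unfolding fin_index_def by (rule finite_subset[of _ "{carrier G}"])
      (auto simp: RCOSETS_def coset_join2 subgroup_self)
  then have "?P (carrier G)"
    using \<K>(2) subgroup_self by blast
  then obtain U where U: "?P U" and max: "\<And>V. ?P V \<Longrightarrow> grp_index G V \<le> grp_index G U"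
    using ex_has_greatest_nat[of ?P "carrier G" "grp_index G" "Suc n"] bound by blast
  have "U \<subseteq> K" if "K \<in> \<K>" for K
  proof -
    have K: "subgroup K G" "fin_index G K" "A \<subseteq> K" using \<K> that by auto
    then have "?P (U \<inter> K)" using U fin_index_Int by (simp add: subgroups_Inter_pair)
    then show ?thesis using subset_if_grp_index_Int_le max U K by blast
  qed
  moreover have "U \<subseteq> carrier G" using U by (auto dest: subgroup.subset)
  ultimately have "U = A" using \<K>(2) U by blast
  then show False using U A(2) by simp
qed

lemma LERF_ratio_less:
  fixes c \<epsilon> :: real
  assumes "LERF G" "fg_subgroup G A" "\<not> fin_index G A" "\<epsilon> > 0"
  obtains U where "subgroup U G" "fin_index G U" "A \<subseteq> U" "c / real (grp_index G U) < \<epsilon>"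
proof -
  obtain n where n: "c < real n * \<epsilon>" using ex_less_of_nat_mult[OF assms(4)] by blast
  obtain U where U: "subgroup U G" "fin_index G U" "A \<subseteq> U" "n < grp_index G U"
    using LERF_index_unbounded[OF assms(1-3)] .
  note n
  also have "real n * \<epsilon> < real (grp_index G U) * \<epsilon>"
    using U(4) assms(4) by (intro mult_strict_right_mono) auto
  finally show thesis
    using that[OF U(1-3)] grp_index_pos[OF U(2)] by (simp add: pos_divide_less_eq mult.commute)
qed

lemma min_gens_Int_ratio_le:
  assumes A: "fg_subgroup G A" "A \<subseteq> U" and U: "subgroup U G" "fin_index G U"
    and V: "subgroup V G" "fin_index G V"
  shows "real (min_gens G (A \<inter> V)) / real (grp_index G (U \<inter> V))
           \<le> real (min_gens G A) / real (grp_index G U)"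
proof -
  have As: "subgroup A G" using A(1) by (rule fg_subgroup_imp_subgroup)
  have "fin_index_in G A (A \<inter> V)"
    using As V by (rule fin_index_in_Int_self)
  then have "min_gens G (A \<inter> V) \<le> rel_index G A (A \<inter> V) * min_gens G A"
    using As V(1) by (intro min_gens_fin_index_le[OF A(1)]) (auto simp: subgroups_Inter_pair)
  then have "grp_index G U * min_gens G (A \<inter> V) \<le> grp_index G U * rel_index G A V * min_gens G A"
    using rel_index_Int[OF As V(1) order_refl] by simp
  also have "\<dots> \<le> grp_index G (U \<inter> V) * min_gens G A"
    using grp_index_mult_rel_index_le[OF U(1) V A(2)] by (rule mult_right_mono) simp
  finally have "real (grp_index G U) * real (min_gens G (A \<inter> V))
      \<le> real (grp_index G (U \<inter> V)) * real (min_gens G A)"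
    by (metis of_nat_le_iff of_nat_mult)
  then show ?thesis
    using grp_index_pos[OF U(2)] grp_index_pos[OF fin_index_Int[OF U(1) V(1) U(2) V(2)]]
    by (simp add: field_simps)
qed

lemma join_fin_index_subgroups_not_fin_index:
  assumes "LERF G" and pos: "rank_gradient G > 0"
    and A: "fg_subgroup G A" "\<not> fin_index G A" and B: "fg_subgroup G B" "\<not> fin_index G B"
  obtains A' B' where
    "subgroup A' G" "A' \<subseteq> A" "fin_index_in G A A'"
    "subgroup B' G" "B' \<subseteq> B" "fin_index_in G B B'"
    "\<not> fin_index G (generate G (A' \<union> B'))"
proof -
  have As: "subgroup A G" and Bs: "subgroup B G"
    using A B by (auto simp: fg_subgroup_def)
  have "rank_gradient G / 2 > 0" using pos by simp
  note ratio_less = LERF_ratio_less[OF assms(1) _ _ this]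
  obtain U where U: "subgroup U G" "fin_index G U" "A \<subseteq> U"
    "real (min_gens G A) / real (grp_index G U) < rank_gradient G / 2"
    using ratio_less[OF A] .
  obtain V where V: "subgroup V G" "fin_index G V" "B \<subseteq> V"
    "real (min_gens G B) / real (grp_index G V) < rank_gradient G / 2"
    using ratio_less[OF B] .
  have A': "subgroup (A \<inter> V) G" "fin_index_in G A (A \<inter> V)"
    and B': "subgroup (B \<inter> U) G" "fin_index_in G B (B \<inter> U)"
    using U V As Bs by (simp_all add: subgroups_Inter_pair fin_index_in_Int_self)
  have "real (min_gens G (A \<inter> V)) / real (grp_index G (U \<inter> V)) < rank_gradient G / 2"
    using min_gens_Int_ratio_le[OF A(1) U(3,1,2) V(1,2)] U(4) by linarith
  moreover have "real (min_gens G (B \<inter> U)) / real (grp_index G (U \<inter> V)) < rank_gradient G / 2"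
    using min_gens_Int_ratio_le[OF B(1) V(3,1,2) U(1,2)] V(4) unfolding Int_commute[of V U] by linarith
  ultimately have "real (min_gens G (A \<inter> V) + min_gens G (B \<inter> U)) / real (grp_index G (U \<inter> V))
      < rank_gradient G"
    unfolding of_nat_add add_divide_distrib by linarith
  then have "\<not> fin_index G (generate G ((A \<inter> V) \<union> (B \<inter> U)))"
    using U V A' B' fg_subgroup_fin_index[OF A(1)] fg_subgroup_fin_index[OF B(1)]
    by (intro not_fin_index_join[where W = "U \<inter> V"]) (auto simp: subgroups_Inter_pair)
  then show thesis using that A' B' by blast
qed

lemma min_gens_normal_mult_ratio_le:
  assumes A: "fg_subgroup G A" and B: "fg_subgroup G B" and N: "N \<lhd> G" "fin_index G N"
    and K: "subgroup K G" "N \<subseteq> K" "fin_index G K"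
  shows "real (min_gens G A + min_gens G (B \<inter> (N <#> A))) / real (grp_index G (N <#> A))
           \<le> real (rel_index G A K * rel_index G B K * (min_gens G A + min_gens G B))
               / real (grp_index G K)"
proof -
  let ?U = "N <#> A"
  have As: "subgroup A G" and Bs: "subgroup B G"
    using A B by (auto simp: fg_subgroup_def)
  have U: "subgroup ?U G" "fin_index G ?U"
    using mult_norm_subgroup[OF N(1) As] fin_index_normal_set_mult[OF N As] by auto
  have "min_gens G (B \<inter> ?U) \<le> rel_index G B ?U * min_gens G B"
    using min_gens_fin_index_le[OF B _ Int_lower1 fin_index_in_Int_self[OF Bs U]]
      rel_index_Int[OF Bs U(1) order_refl] Bs U(1) by (simp add: subgroups_Inter_pair)
  moreover have "rel_index G B ?U > 0"
    using subgroup.one_closed[OF Bs] U(2) subgroup.subset[OF Bs]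
    by (intro rel_index_pos fin_index_imp_fin_index_in) auto
  then have "1 * min_gens G A \<le> rel_index G B ?U * min_gens G A"
    by (intro mult_le_mono1) simp
  ultimately have "min_gens G A + min_gens G (B \<inter> ?U)
      \<le> rel_index G B ?U * (min_gens G A + min_gens G B)"
    unfolding add_mult_distrib2 by linarith
  then have "(min_gens G A + min_gens G (B \<inter> ?U)) * grp_index G K
      \<le> (rel_index G B ?U * (min_gens G A + min_gens G B)) * grp_index G K"
    by (rule mult_le_mono1)
  also have "\<dots> = (rel_index G B ?U * grp_index G K) * (min_gens G A + min_gens G B)"
    by (simp only: ac_simps)
  also have "\<dots> \<le> (rel_index G A K * rel_index G B K * grp_index G ?U)
      * (min_gens G A + min_gens G B)"
    using rel_index_normal_mult_le[OF N As Bs K] by (rule mult_le_mono1)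
  finally have "real (min_gens G A + min_gens G (B \<inter> ?U)) * real (grp_index G K)
      \<le> real (rel_index G A K * rel_index G B K * (min_gens G A + min_gens G B))
        * real (grp_index G ?U)"
    by (simp only: ac_simps flip: of_nat_mult of_nat_le_iff)
  then show ?thesis
    using grp_index_pos[OF U(2)] grp_index_pos[OF K(3)] by (simp add: divide_simps mult.commute)
qed

lemma exists_fin_index_join_not_fin_index:
  assumes "LERF G" and pos: "rank_gradient G > 0"
    and A: "fg_subgroup G A" and B: "fg_subgroup G B"
    and A': "subgroup A' G" "A' \<subseteq> A" "fin_index_in G A A'"
    and B': "subgroup B' G" "B' \<subseteq> B" "fin_index_in G B B'"
    and inf: "\<not> fin_index G (generate G (A' \<union> B'))"
  obtains H where "subgroup H G" "H \<subseteq> B" "fin_index_in G B H"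
    "\<not> fin_index G (generate G (A \<union> H))"
proof -
  have As: "subgroup A G" and Bs: "subgroup B G"
    using A B by (auto simp: fg_subgroup_def)
  note Ac = subgroup.subset[OF As] and Bc = subgroup.subset[OF Bs]
  have C: "fg_subgroup G (generate G (A' \<union> B'))"
    by (intro fg_subgroup_join fg_subgroup_fin_index[OF A A'] fg_subgroup_fin_index[OF B B'])
  let ?c = "\<lambda>A' B'. rel_index G A A' * rel_index G B B' * (min_gens G A + min_gens G B)"
  obtain K where K: "subgroup K G" "fin_index G K" "generate G (A' \<union> B') \<subseteq> K"
    and small: "real (?c A' B') / real (grp_index G K) < rank_gradient G"
    using LERF_ratio_less[OF assms(1) C inf pos] .
  have "A' \<subseteq> K" "B' \<subseteq> K" using K(3) by (auto intro: generate.incl)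
  then have "?c K K \<le> ?c A' B'"
    using rel_index_antimono[OF A'(1) K(1) _ Ac A'(3)] rel_index_antimono[OF B'(1) K(1) _ Bc B'(3)]
    by (intro mult_le_mono) auto
  define U where "U = normal_core G K <#> A"
  note N = normal_normal_core[OF K(1)] fin_index_normal_core[OF K(1,2)]
  have U: "subgroup U G" "fin_index G U" "A \<subseteq> U"
    using mult_norm_subgroup[OF N(1) As] fin_index_normal_set_mult[OF N As]
      second_isomorphism_grp.S_contained_in_set_mult[OF second_isomorphism_grpI[OF N(1) As]]
    unfolding U_def by auto
  have H: "subgroup (B \<inter> U) G" "fin_index_in G B (B \<inter> U)"
    using Bs U by (simp_all add: subgroups_Inter_pair fin_index_in_Int_self)
  have "real (min_gens G A + min_gens G (B \<inter> U)) / real (grp_index G U)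
      \<le> real (?c K K) / real (grp_index G K)"
    unfolding U_def by (rule min_gens_normal_mult_ratio_le[OF A B N K(1) normal_core_subset K(2)])
  also have "\<dots> \<le> real (?c A' B') / real (grp_index G K)"
    using \<open>?c K K \<le> ?c A' B'\<close> by (intro divide_right_mono of_nat_mono) auto
  also note small
  finally have "\<not> fin_index G (generate G (A \<union> (B \<inter> U)))"
    using U fg_subgroup_fin_index[OF B H(1) _ H(2)] by (intro not_fin_index_join[OF A]) auto
  then show thesis using that[of "B \<inter> U"] H by auto
qed

end

theorem theorem1p1:
  fixes G :: "('a, 'b) monoid_scheme" and A B :: "'a set"
  assumes "group G" and "fg_group G" and "LERF G" and "rank_gradient G > 0"
    and "fg_subgroup G A" and "\<not> fin_index G A"
    and "fg_subgroup G B" and "\<not> fin_index G B"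
  shows "\<exists>H. subgroup H G \<and> H \<subseteq> B \<and> fin_index_in G B H \<and>
             \<not> fin_index G (generate G (A \<union> H))"
proof -
  interpret group G by fact
  obtain A' B' where A': "subgroup A' G" "A' \<subseteq> A" "fin_index_in G A A'"
    and B': "subgroup B' G" "B' \<subseteq> B" "fin_index_in G B B'"
    and "\<not> fin_index G (generate G (A' \<union> B'))"
    using join_fin_index_subgroups_not_fin_index[OF assms(3-8)] .
  then obtain H where "subgroup H G" "H \<subseteq> B" "fin_index_in G B H"
    "\<not> fin_index G (generate G (A \<union> H))"
    using exists_fin_index_join_not_fin_index[OF assms(3,4,5,7) A' B'] by metis
  then show ?thesis by blast
qed

end
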